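(* Let $\mathsf J\subseteq[n-1]$ and $k\in\mathsf J$. Then $\mathcal S_{k,\square}$ can be uniquely extended to a maximal collection $\mathcal S_{\mathsf J,k,\square}$ of weakly separated $\mathsf J$-sets, by adding all the cointerval $t$-sets for $t\in\mathsf J$ with $t<k$ and all the interval $t$-sets for $t\in\mathsf J$ with $t>k$.
   Context: Fix an integer $n>1$; $[n]=\{1,\dots,n\}$. An interval is a set $[i,j]=\{i,i+1,\dots,j\}$; a cointerval is the complement in $[n]$ of an interval subset of $[n]$. A $k$-set is a $k$-element subset of $[n]$; a $\mathsf J$-set is a subset $I\subseteq[n]$ with $|I|\in\mathsf J$. Write $A<B$ if $a<b$ for all $a\in A,b\in B$. Subsets $I,J\subseteq[n]$ are weakly separated if (i) $|I|\ge|J|$ and $J\setminus I$ is a disjoint union $J'\cup J''$ with $J'<(I\setminus J)<J''$, or (ii) $|J|\ge|I|$ and $I\setminus J$ is a disjoint union $I'\cup I''$ with $I'<(J\setminus I)<I''$. A collection is weakly separated if its members are pairwise weakly separated; maximality is with respect to inclusion among weakly separated collections of $\mathsf J$-sets. $\mathcal S_{k,\square}$ is the collection consisting of the interval $k$-sets and the $k$-sets which contain $1$ and are unions of two intervals. *)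

theory Defs
  imports Main
begin

text \<open>The ground set \<open>[n]\<close> is \<open>{1..n} :: nat set\<close>.\<close>

definition set_less :: "nat set \<Rightarrow> nat set \<Rightarrow> bool" where
  "set_less A B \<longleftrightarrow> (\<forall>a\<in>A. \<forall>b\<in>B. a < b)"

definition interval_set :: "nat set \<Rightarrow> bool" where
  "interval_set I \<longleftrightarrow> (\<exists>i j. i \<le> j \<and> I = {i..j})"

definition cointerval_set :: "nat \<Rightarrow> nat set \<Rightarrow> bool" where
  "cointerval_set n I \<longleftrightarrow> (\<exists>L. interval_set L \<and> L \<subseteq> {1..n} \<and> I = {1..n} - L)"

definition k_sets :: "nat \<Rightarrow> nat \<Rightarrow> nat set set" where
  "k_sets n k = {I. I \<subseteq> {1..n} \<and> card I = k}"

definition J_sets :: "nat \<Rightarrow> nat set \<Rightarrow> nat set set" where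
  "J_sets n J = {I. I \<subseteq> {1..n} \<and> card I \<in> J}"

text \<open>Here \<open>surrounds B A\<close> says that \<open>B - A\<close> splits into a part to the left and a part to the
  right of \<open>A - B\<close>; either part may be empty.\<close>

definition surrounds :: "nat set \<Rightarrow> nat set \<Rightarrow> bool" where
  "surrounds B A \<longleftrightarrow>
     (\<exists>B' B''. B - A = B' \<union> B'' \<and> B' \<inter> B'' = {} \<and> set_less B' (A - B) \<and> set_less (A - B) B'')"

definition weakly_separated :: "nat set \<Rightarrow> nat set \<Rightarrow> bool" where
  "weakly_separated A B \<longleftrightarrow>
     (card A \<ge> card B \<and> surrounds B A) \<or> (card B \<ge> card A \<and> surrounds A B)"

text \<open>Every set is weakly separated from itself, so no distinctness condition is needed.\<close>

definition ws_collection :: "nat set set \<Rightarrow> bool" where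
  "ws_collection C \<longleftrightarrow> (\<forall>A\<in>C. \<forall>B\<in>C. weakly_separated A B)"

definition max_ws_collection :: "nat \<Rightarrow> nat set \<Rightarrow> nat set set \<Rightarrow> bool" where
  "max_ws_collection n J C \<longleftrightarrow>
     C \<subseteq> J_sets n J \<and> ws_collection C \<and>
     (\<forall>D. D \<subseteq> J_sets n J \<and> ws_collection D \<and> C \<subseteq> D \<longrightarrow> D = C)"

definition S_square :: "nat \<Rightarrow> nat \<Rightarrow> nat set set" where
  "S_square n k =
     {I \<in> k_sets n k. interval_set I} \<union>
     {I \<in> k_sets n k. 1 \<in> I \<and> (\<exists>A B. interval_set A \<and> interval_set B \<and> I = A \<union> B)}"

definition SJ_square :: "nat \<Rightarrow> nat set \<Rightarrow> nat \<Rightarrow> nat set set" where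
  "SJ_square n J k =
     S_square n k \<union>
     (\<Union>t\<in>{t \<in> J. t < k}. {I \<in> k_sets n t. cointerval_set n I}) \<union>
     (\<Union>t\<in>{t \<in> J. t > k}. {I \<in> k_sets n t. interval_set I})"

end

theory Submission
  imports Defs
begin

text \<open>
  The theorem says two things: the members of \<open>SJ_square n J k\<close> are pairwise weakly separated, and
  every \<open>J\<close>-set that is weakly separated from all of \<open>S_square n k\<close> already belongs to
  \<open>SJ_square n J k\<close>. Maximality and uniqueness of the extension both follow from these.

  Pairwise separation rests on two remarks. An interval is surrounded by every set, hence is weakly
  separated from every set of at most its size; dually, a cointerval surrounds every set, hence is
  weakly separated from every set of at least its size. This leaves only pairs of \<open>k\<close>-sets
  \<open>{1..a} \<union> {b..c}\<close>, and of two such sets the one with the longer initial segment surrounds the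
  other.

  For the second part, let \<open>X\<close> be a \<open>t\<close>-set outside \<open>SJ_square n J k\<close>. A member of \<open>S_square n k\<close>
  that is not weakly separated from \<open>X\<close> is built by choosing a few points to be put into it and a
  few to be kept out of it, as follows.

  \<^item> If \<open>t > k\<close>, then \<open>X\<close> is not an interval, so it misses some \<open>g\<close> strictly between its minimum and
    its maximum. As at least \<open>k\<close> points lie strictly between these two, some interval \<open>k\<close>-set
    contains \<open>g\<close> and neither of them, so it does not surround \<open>X\<close>.
  \<^item> If \<open>t < k\<close>, then \<open>X\<close> is not a cointerval. Let \<open>g\<close> be the least point missing from \<open>X\<close>; then
    there are \<open>g < x < h\<close> with \<open>x \<in> X\<close> and \<open>h \<notin> X\<close>. Some \<open>k\<close>-set \<open>{1..a} \<union> {b..c}\<close> contains \<open>g\<close>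
    and \<open>h\<close> but not \<open>x\<close>, so \<open>X\<close> does not surround it.
  \<^item> If \<open>t = k\<close>, then again with \<open>g\<close> the least missing point there are \<open>g < x < h < Max X\<close> with
    \<open>x \<in> X\<close> and \<open>h \<notin> X\<close>, and some \<open>k\<close>-set \<open>{1..a} \<union> {b..c}\<close> contains \<open>g\<close> and \<open>h\<close> but neither \<open>x\<close>
    nor \<open>Max X\<close>. The alternation \<open>g < x < h < Max X\<close> excludes both ways of being separated.

  Taking \<open>g\<close> least puts \<open>{1..<g}\<close> into \<open>X\<close>, which bounds \<open>g\<close> in terms of the size of \<open>X\<close>
  and leaves room for a set with exactly \<open>k\<close> elements (lemma \<open>two_interval_set_separating\<close>).
\<close>

section \<open>Surrounding and weak separation\<close>

lemma weakly_separated_sym: "weakly_separated A B \<Longrightarrow> weakly_separated B A"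
  unfolding weakly_separated_def by blast

text \<open>The points of \<open>B\<close> outside an interval containing \<open>A - B\<close> lie on its two sides, which gives
  the required splitting.\<close>

lemma surrounds_if_interval_between:
  assumes "A - B \<subseteq> {b..c}" and "(B - A) \<inter> {b..c} = {}"
  shows "surrounds B A"
proof -
  let ?L = "{y \<in> B - A. y < b}" and ?R = "{y \<in> B - A. \<not> y < b}"
  have inside: "b \<le> x \<and> x \<le> c" if "x \<in> A - B" for x
    using assms(1) that by (auto simp: subset_iff)
  have outside: "y < b \<or> c < y" if "y \<in> B - A" for y
    using assms(2) that by (auto simp: disjoint_iff not_le)
  have "set_less ?L (A - B)" and "set_less (A - B) ?R"
    unfolding set_less_def using inside outside by (blast intro: less_le_trans le_less_trans)+
  moreover have "B - A = ?L \<union> ?R" and "?L \<inter> ?R = {}" by blast+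
  ultimately show ?thesis unfolding surrounds_def by blast
qed

lemma surrounds_not_between:
  assumes "surrounds B A" and "y \<in> B - A" and "x \<in> A - B" and "x' \<in> A - B"
  shows "\<not> (x < y \<and> y < x')"
proof -
  obtain L R where "B - A = L \<union> R" "set_less L (A - B)" "set_less (A - B) R"
    using assms(1) unfolding surrounds_def by blast
  then have "y < x \<or> x' < y" using assms(2-4) unfolding set_less_def by blast
  then show ?thesis by auto
qed

lemma interval_surrounded:
  assumes "interval_set A"
  shows "surrounds B A"
  using assms unfolding interval_set_def by (auto intro!: surrounds_if_interval_between)

lemma cointerval_surrounds:
  assumes "cointerval_set n B" and "A \<subseteq> {1..n}"
  shows "surrounds B A"
proof -
  obtain i j where "B = {1..n} - {i..j}"
    using assms(1) unfolding cointerval_set_def interval_set_def by blast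
  then show ?thesis using assms(2) by (intro surrounds_if_interval_between[of _ _ i j]) auto
qed

text \<open>With \<open>a \<le> a'\<close>, everything that the first set has and the second has not lies in \<open>{b..c}\<close>.\<close>

lemma two_interval_surrounded:
  fixes a a' :: nat
  assumes "a \<le> a'"
  shows "surrounds ({1..a'} \<union> {b'..c'}) ({1..a} \<union> {b..c})"
  using assms by (intro surrounds_if_interval_between[of _ _ b c]) auto

lemma two_interval_sets_weakly_separated:
  fixes a a' :: nat
  assumes "card ({1..a} \<union> {b..c}) = card ({1..a'} \<union> {b'..c'})"
  shows "weakly_separated ({1..a} \<union> {b..c}) ({1..a'} \<union> {b'..c'})"
  unfolding weakly_separated_def assms
  using two_interval_surrounded[of a a' b' c' b c] two_interval_surrounded[of a' a b c b' c']
  by (metis nle_le)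

section \<open>The two-interval sets\<close>

lemma two_interval_form:
  assumes "1 \<in> I" and "I = A \<union> B" and "interval_set A" and "interval_set B" and "I \<subseteq> {1..n}"
  shows "\<exists>a b c. I = {1..a} \<union> {b..c}"
proof -
  obtain i j i' j' where *: "i \<le> j" "A = {i..j}" "i' \<le> j'" "B = {i'..j'}"
    using assms(3,4) unfolding interval_set_def by blast
  have "i \<ge> 1" and "i' \<ge> 1" using assms(2,5) * by auto
  moreover have "i \<le> 1 \<or> i' \<le> 1" using assms(1,2) * by auto
  ultimately have "i = 1 \<or> i' = 1" by linarith
  then show ?thesis
  proof
    assume "i = 1"
    then have "I = {1..j} \<union> {i'..j'}" using assms(2) * by simp
    then show ?thesis by blast
  next
    assume "i' = 1"
    then have "I = {1..j'} \<union> {i..j}" using assms(2) * by (simp add: Un_commute)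
    then show ?thesis by blast
  qed
qed

lemma S_square_cases:
  assumes "I \<in> S_square n k"
  obtains "interval_set I" | a b c where "I = {1..a} \<union> {b..c}"
proof (cases "interval_set I")
  case False
  then obtain A B where "1 \<in> I" "I = A \<union> B" "interval_set A" "interval_set B" "I \<subseteq> {1..n}"
    using assms unfolding S_square_def k_sets_def by blast
  from two_interval_form[OF this] that(2) show ?thesis by (elim exE)
qed (rule that(1))

lemma S_square_subset_k_sets: "S_square n k \<subseteq> k_sets n k"
  unfolding S_square_def by blast

lemma two_interval_set_in_S_square:
  assumes "{1..a} \<union> {b..c} \<subseteq> {1..n}" and "card ({1..a} \<union> {b..c}) = k" and "1 \<le> a" and "b \<le> c"
  shows "{1..a} \<union> {b..c} \<in> S_square n k"
proof -
  have "interval_set {1..a}" and "interval_set {b..c}" and "1 \<in> {1..a} \<union> {b..c}"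
    using assms(3,4) unfolding interval_set_def by auto
  then show ?thesis using assms(1,2) unfolding S_square_def k_sets_def by blast
qed

lemma interval_of_size_around:
  fixes lo g hi s :: nat
  assumes "1 \<le> lo" "lo \<le> g" "g \<le> hi" "1 \<le> s" "s + lo \<le> hi + 1"
  obtains b c where "lo \<le> b" "b \<le> g" "g \<le> c" "c \<le> hi" "card {b..c} = s"
proof
  \<comment> \<open>The right end is \<open>g\<close> unless this would push the left end below \<open>lo\<close>.\<close>
  let ?b = "max lo (g + 1 - s)"
  show "lo \<le> ?b" "?b \<le> g" "g \<le> ?b + s - 1" "?b + s - 1 \<le> hi" "card {?b..?b + s - 1} = s"
    using assms by auto
qed

text \<open>Such a set has at least the \<open>g + 1\<close> elements of \<open>{1..g} \<union> {h}\<close> and at most the \<open>N - 1\<close>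
  elements of \<open>{1..N} - {x}\<close>; every size between these bounds is attained.\<close>

lemma two_interval_set_separating:
  fixes g x h N n k :: nat
  assumes "1 \<le> g" "g < x" "x < h" "h \<le> N" "g + 1 \<le> k" "k + 1 \<le> N" "N \<le> n"
  obtains Y where "Y \<in> S_square n k" "Y \<subseteq> {1..N}" "g \<in> Y" "h \<in> Y" "x \<notin> Y"
proof -
  define s where "s = min (k - g) (N - x)"
  define a where "a = k - s"
  have s: "1 \<le> s" "s + (x + 1) \<le> N + 1" and a: "g \<le> a" "a < x" "a + s = k"
    using assms unfolding s_def a_def by auto
  obtain b c where bc: "x + 1 \<le> b" "b \<le> h" "h \<le> c" "c \<le> N" "card {b..c} = s"
    using interval_of_size_around[of "x + 1" h N s] assms s by auto
  let ?Y = "{1..a} \<union> {b..c}"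
  have "{1..a} \<inter> {b..c} = {}" using a bc by auto
  then have "card ?Y = k" using a bc(5) by (subst card_Un_disjoint) auto
  moreover have "?Y \<subseteq> {1..N}" using assms a bc by auto
  ultimately have "?Y \<in> S_square n k"
    using assms a bc by (intro two_interval_set_in_S_square) auto
  moreover have "g \<in> ?Y" "h \<in> ?Y" "x \<notin> ?Y" using assms a bc by auto
  ultimately show ?thesis using that \<open>?Y \<subseteq> {1..N}\<close> by blast
qed

section \<open>Gaps of a finite set\<close>

lemma interval_setI_no_gap:
  assumes "finite X" and "X \<noteq> {}" and "\<And>g. Min X < g \<Longrightarrow> g < Max X \<Longrightarrow> g \<in> X"
  shows "interval_set X"
proof -
  have "X = {Min X..Max X}"
  proof
    show "{Min X..Max X} \<subseteq> X"
      using assms Min_in Max_in by (metis atLeastAtMost_iff nless_le subsetI)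
  qed (use assms in auto)
  then show ?thesis unfolding interval_set_def using assms Min_in by (metis Max_ge)
qed

lemma least_missing_point:
  assumes "X \<subseteq> {1..n}" and "card X < n"
  obtains g where "1 \<le> g" "g \<le> n" "g \<notin> X" "{1..<g} \<subseteq> X"
proof -
  let ?G = "{1..n} - X"
  have "?G \<noteq> {}" using assms by (metis Diff_eq_empty_iff card_atLeastAtMost diff_Suc_1 nless_le subset_antisym)
  then have "Min ?G \<in> ?G" by (intro Min_in) auto
  moreover have "{1..<Min ?G} \<subseteq> X"
  proof
    fix y assume "y \<in> {1..<Min ?G}"
    moreover from this have "y \<notin> ?G" using Min_le[of ?G y]
      by (metis atLeastLessThan_iff finite_Diff finite_atLeastAtMost not_le)
    moreover have "Min ?G \<le> n" using \<open>Min ?G \<in> ?G\<close> by simp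
    ultimately show "y \<in> X" by simp
  qed
  ultimately show ?thesis using that[of "Min ?G"] by auto
qed

section \<open>Sets weakly separated from all members of \<open>S_square\<close>\<close>

text \<open>A test set smaller than \<open>X\<close> would have to surround \<open>X\<close>, so it suffices to fit an interval
  \<open>k\<close>-set around a gap of \<open>X\<close> and strictly between the two extreme points of \<open>X\<close>.\<close>

lemma large_set_interval:
  assumes X: "X \<subseteq> {1..n}" "k < card X" and "1 \<le> k"
    and ws: "\<And>Y. Y \<in> S_square n k \<Longrightarrow> weakly_separated X Y"
  shows "interval_set X"
proof (rule interval_setI_no_gap)
  show fin: "finite X" using X finite_subset by blast
  show ne: "X \<noteq> {}" using X by auto
  fix g assume g: "Min X < g" "g < Max X"
  show "g \<in> X"
  proof (rule ccontr)
    assume "g \<notin> X"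
    have ends: "Min X \<in> X" "Max X \<in> X" using fin ne by auto
    \<comment> \<open>The gap \<open>g\<close> leaves room for a \<open>k\<close>-set strictly between the two ends.\<close>
    have "X \<subseteq> {Min X..Max X} - {g}" using fin \<open>g \<notin> X\<close> by auto
    then have "card X \<le> card ({Min X..Max X} - {g})" by (intro card_mono) auto
    also have "\<dots> = Max X - Min X" using g by (subst card_Diff_singleton) auto
    finally have room: "k + (Min X + 1) \<le> (Max X - 1) + 1" using X g by linarith
    obtain b c where bc: "Min X + 1 \<le> b" "b \<le> g" "g \<le> c" "c \<le> Max X - 1" "card {b..c} = k"
      by (rule interval_of_size_around[of "Min X + 1" g "Max X - 1" k])
        (use g room \<open>1 \<le> k\<close> in \<open>linarith | blast\<close>)+
    have "Max X \<le> n" using ends X by auto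
    then have "{b..c} \<subseteq> {1..n}" using bc by auto
    moreover have "interval_set {b..c}" unfolding interval_set_def using bc le_trans by blast
    ultimately have "{b..c} \<in> S_square n k" unfolding S_square_def k_sets_def using bc(5) by blast
    from ws[OF this] have "surrounds {b..c} X"
      unfolding weakly_separated_def using bc X by auto
    moreover have "g \<in> {b..c} - X" "Min X \<in> X - {b..c}" "Max X \<in> X - {b..c}"
      using ends bc g \<open>g \<notin> X\<close> by auto
    ultimately show False using surrounds_not_between g by blast
  qed
qed

text \<open>A test set larger than \<open>X\<close> would have to be surrounded by \<open>X\<close>, so it suffices to fit a
  test set that contains two missing points of \<open>X\<close> and avoids a point of \<open>X\<close> between them. These
  exist as soon as the complement of \<open>X\<close> has a gap.\<close>

lemma small_set_cointerval:
  assumes X: "X \<subseteq> {1..n}" "card X < k" and "k < n"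
    and ws: "\<And>Y. Y \<in> S_square n k \<Longrightarrow> weakly_separated X Y"
  shows "cointerval_set n X"
proof -
  have fin: "finite X" using X finite_subset by blast
  obtain g where g: "1 \<le> g" "g \<le> n" "g \<notin> X" "{1..<g} \<subseteq> X"
    using least_missing_point[of X n] assms by auto
  let ?G = "{1..n} - X"
  have "g \<in> ?G" using g by auto
  moreover have "g \<le> y" if "y \<in> ?G" for y
    using that g(4) by (metis DiffD1 DiffD2 atLeastAtMost_iff atLeastLessThan_iff in_mono not_le)
  ultimately have Min: "Min ?G = g" by (intro Min_eqI) auto
  have "interval_set ?G"
  proof (rule interval_setI_no_gap)
    show "?G \<noteq> {}" using g by auto
    fix x assume "Min ?G < x" "x < Max ?G"
    then have x: "g < x" "x < Max ?G" using Min by auto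
    have h: "Max ?G \<in> ?G" using \<open>?G \<noteq> {}\<close> by (intro Max_in) auto
    show "x \<in> ?G"
    proof (rule ccontr)
      assume "x \<notin> ?G"
      then have "x \<in> X" using x h by auto
      then have "card (insert x {1..<g}) \<le> card X" using g fin by (intro card_mono) auto
      then have lower: "g + 1 \<le> k" using x X g by simp
      obtain Y where Y: "Y \<in> S_square n k" "g \<in> Y" "Max ?G \<in> Y" "x \<notin> Y"
        by (rule two_interval_set_separating[of g x "Max ?G" n k n])
          (use g x h lower \<open>k < n\<close> in \<open>simp | blast\<close>)+
      then have "card Y = k" using S_square_subset_k_sets unfolding k_sets_def by blast
      then have "surrounds X Y"
        using ws[OF Y(1)] X unfolding weakly_separated_def by auto
      then show False
        using surrounds_not_between[of X Y x g "Max ?G"] Y \<open>x \<in> X\<close> g x h by auto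
    qed
  qed auto
  moreover have "X = {1..n} - ?G" using X by auto
  ultimately show ?thesis unfolding cointerval_set_def by blast
qed

text \<open>Between sets of equal size either direction of surrounding would do, so both have to be
  excluded: hence the second point of \<open>X\<close>, its maximum, beyond the second missing point. If no
  such alternation exists, the part of \<open>X\<close> beyond its least missing point is empty or an interval,
  and this puts \<open>X\<close> into \<open>S_square n k\<close>.\<close>

lemma k_set_in_S_square:
  assumes X: "X \<in> k_sets n k" and k: "1 \<le> k" "k < n"
    and ws: "\<And>Y. Y \<in> S_square n k \<Longrightarrow> weakly_separated X Y"
  shows "X \<in> S_square n k"
proof -
  have sub: "X \<subseteq> {1..n}" and card: "card X = k" using X unfolding k_sets_def by auto
  have fin: "finite X" using sub finite_subset by blast
  obtain g where g: "1 \<le> g" "g \<le> n" "g \<notin> X" "{1..<g} \<subseteq> X"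
    using least_missing_point[of X n] sub card k by auto
  let ?R = "{x \<in> X. g < x}"
  have off_g: "1 \<le> y \<and> (y < g \<or> g < y)" if "y \<in> X" for y
    using that g(3) sub by (metis atLeastAtMost_iff in_mono nat_neq_iff)
  then have X_eq: "X = {1..<g} \<union> ?R" using g(4) by fastforce
  have initial: "{1..<g} = {1..g - 1}" using g(1) by auto
  show ?thesis
  proof (cases "?R = {}")
    case True
    then have "X = {1..<g}" using X_eq by (metis sup_bot.right_neutral)
    then have "X = {1..g - 1}" using initial by simp
    moreover from this have "1 \<le> g - 1" using card k by auto
    ultimately have "interval_set X" unfolding interval_set_def by blast
    then show ?thesis using X unfolding S_square_def by blast
  next
    case ne: False
    have "finite ?R" using fin by auto
    then have ends: "Min ?R \<in> ?R" "Max ?R \<in> ?R" using ne by (metis Min_in, metis Max_in)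
    define x M where "x = Min ?R" and "M = Max ?R"
    have x: "x \<in> X" "g < x" and M: "M \<in> X" "M \<le> n" using ends sub unfolding x_def M_def by auto
    have bound: "X \<subseteq> {1..M}"
    proof
      fix y assume "y \<in> X"
      then have "y < g \<or> y \<in> ?R" using off_g by blast
      moreover have "g < M" using ends unfolding M_def by auto
      ultimately have "y \<le> M" using \<open>finite ?R\<close> unfolding M_def by (auto intro: Max_ge)
      then show "y \<in> {1..M}" using \<open>y \<in> X\<close> sub by auto
    qed
    have int: "interval_set ?R"
    proof (rule interval_setI_no_gap[OF \<open>finite ?R\<close> ne])
      fix h assume "Min ?R < h" "h < Max ?R"
      then have h: "x < h" "h < M" unfolding x_def M_def by auto
      show "h \<in> ?R"
      proof (rule ccontr)
        assume "h \<notin> ?R"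
        then have "h \<notin> X" using h x by auto
        have "card (insert x (insert M {1..<g})) \<le> card X"
          using x M g fin by (intro card_mono) auto
        moreover have "card (insert x (insert M {1..<g})) = g + 1" using x h g by simp
        ultimately have lower: "g + 1 \<le> k" using card by simp
        have "X \<subseteq> {1..M} - {g, h}" using bound g(3) \<open>h \<notin> X\<close> by auto
        then have "card X \<le> card ({1..M} - {g, h})" by (intro card_mono) auto
        also have "\<dots> = M - 2" using x h g by (subst card_Diff_subset) auto
        finally have upper: "k + 1 \<le> M - 1" using card h by simp
        \<comment> \<open>Staying inside \<open>{1..M - 1}\<close> keeps \<open>M\<close> out.\<close>
        obtain Y where Y: "Y \<in> S_square n k" "Y \<subseteq> {1..M - 1}" "g \<in> Y" "h \<in> Y" "x \<notin> Y"
          by (rule two_interval_set_separating[of g x h "M - 1" k n])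
            (use g x h M lower upper in \<open>linarith | blast\<close>)+
        have "M \<notin> Y" using Y(2) h by auto
        have "\<not> surrounds Y X"
          using surrounds_not_between[of Y X h x M] Y \<open>M \<notin> Y\<close> \<open>h \<notin> X\<close> x M h by blast
        moreover have "\<not> surrounds X Y"
          using surrounds_not_between[of X Y x g h] Y g \<open>h \<notin> X\<close> x h by blast
        ultimately show False using ws[OF Y(1)] unfolding weakly_separated_def by blast
      qed
    qed
    show ?thesis
    proof (cases "g = 1")
      case True
      then have "X = ?R" using X_eq by auto
      then have "interval_set X" using int by simp
      then show ?thesis using X unfolding S_square_def by blast
    next
      case False
      then have "1 \<le> g - 1" and "1 \<in> X" using g by auto
      then have "interval_set {1..<g}" unfolding interval_set_def initial by blast
      then show ?thesis
        using X int X_eq \<open>1 \<in> X\<close> unfolding S_square_def by blast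
    qed
  qed
qed

section \<open>The extended collection\<close>

lemma SJ_square_cases:
  assumes "I \<in> SJ_square n J k"
  obtains "I \<in> S_square n k" "card I = k"
  | "cointerval_set n I" "card I < k"
  | "interval_set I" "k < card I"
  using assms S_square_subset_k_sets unfolding SJ_square_def k_sets_def by fastforce

lemma SJ_square_subset_J_sets:
  assumes "k \<in> J"
  shows "SJ_square n J k \<subseteq> J_sets n J"
  using assms S_square_subset_k_sets unfolding SJ_square_def k_sets_def J_sets_def by fastforce

lemma ws_collection_SJ_square:
  assumes "k \<in> J"
  shows "ws_collection (SJ_square n J k)"
proof -
  have ordered: "weakly_separated A B"
    if A: "A \<in> SJ_square n J k" and B: "B \<in> SJ_square n J k" and le: "card A \<le> card B" for A B
  proof -
    have sub: "B \<subseteq> {1..n}" using SJ_square_subset_J_sets[OF assms] B unfolding J_sets_def by blast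
    consider (sep) "cointerval_set n A \<or> interval_set B"
      | (square) "A \<in> S_square n k" "B \<in> S_square n k" "card A = k" "card B = k"
      using A B le by (elim SJ_square_cases) auto
    then show ?thesis
    proof cases
      case sep
      then have "surrounds A B" using cointerval_surrounds interval_surrounded sub by blast
      then show ?thesis using le unfolding weakly_separated_def by blast
    next
      case square
      then have eq: "card A = card B" by simp
      have "weakly_separated A B" if "interval_set A \<or> interval_set B"
        using that eq interval_surrounded unfolding weakly_separated_def by auto
      then show ?thesis
        using two_interval_sets_weakly_separated eq square(1,2) by (metis S_square_cases)
    qed
  qed
  then show ?thesis
    unfolding ws_collection_def using weakly_separated_sym by (meson nle_le)
qed

lemma in_SJ_square_if_weakly_separated:
  assumes "X \<in> J_sets n J" and "1 \<le> k" and "k < n"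
    and ws: "\<And>Y. Y \<in> S_square n k \<Longrightarrow> weakly_separated X Y"
  shows "X \<in> SJ_square n J k"
proof -
  have X: "X \<subseteq> {1..n}" "card X \<in> J" using assms(1) unfolding J_sets_def by auto
  consider "card X < k" | "card X = k" | "k < card X" by linarith
  then show ?thesis
  proof cases
    case 1
    then have "cointerval_set n X" using small_set_cointerval assms X by blast
    then show ?thesis using X 1 unfolding SJ_square_def k_sets_def by auto
  next
    case 2
    then have "X \<in> S_square n k" using k_set_in_S_square assms X unfolding k_sets_def by blast
    then show ?thesis unfolding SJ_square_def by blast
  next
    case 3
    then have "interval_set X" using large_set_interval assms X by blast
    then show ?thesis using X 3 unfolding SJ_square_def k_sets_def by auto
  qed
qed

theorem proposition11p2:
  fixes n k :: nat and J :: "nat set"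
  assumes "n > 1" and "J \<subseteq> {1..n - 1}" and "k \<in> J"
  shows "max_ws_collection n J (SJ_square n J k) \<and>
    S_square n k \<subseteq> SJ_square n J k \<and>
    (\<forall>C. max_ws_collection n J C \<and> S_square n k \<subseteq> C \<longrightarrow> C = SJ_square n J k)"
proof -
  have k: "1 \<le> k" "k < n" using assms by force+
  have S: "S_square n k \<subseteq> SJ_square n J k" unfolding SJ_square_def by blast
  have upper: "C \<subseteq> SJ_square n J k"
    if "C \<subseteq> J_sets n J" "ws_collection C" "S_square n k \<subseteq> C" for C
    using that in_SJ_square_if_weakly_separated[OF _ k] unfolding ws_collection_def by blast
  have SJ: "SJ_square n J k \<subseteq> J_sets n J" "ws_collection (SJ_square n J k)"
    using SJ_square_subset_J_sets ws_collection_SJ_square assms(3) by auto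
  have "max_ws_collection n J (SJ_square n J k)"
    unfolding max_ws_collection_def using SJ S upper by (meson subset_antisym subset_trans)
  moreover have "C = SJ_square n J k" if "max_ws_collection n J C" "S_square n k \<subseteq> C" for C
    using that upper[of C] SJ unfolding max_ws_collection_def by blast
  ultimately show ?thesis using S by blast
qed

end
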